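(* Let $n,m\ge 2$ be integers. If $n=3t+1$ and $m=3r+2$ for some nonnegative integers $t,r$, then $$b(P_n\boxtimes P_m)=3.$$
   Context: All graphs are finite, simple and undirected. $P_k$ denotes the path with $k$ vertices. The strong product $G\boxtimes H$ of graphs $G$ and $H$ has vertex set $V(G)\times V(H)$, and two vertices $(v,u)$ and $(v',u')$ are adjacent if and only if ($v=v'$ and $u\sim u'$), or ($v\sim v'$ and $u=u'$), or ($v\sim v'$ and $u\sim u'$), where $\sim$ denotes adjacency. A set $D$ of vertices of $G$ is dominating if every vertex of $G$ is in $D$ or adjacent to a vertex of $D$; the domination number $\gamma(G)$ is the minimum cardinality of a dominating set. For a graph $G$ with nonempty edge set $E$, the bondage number $b(G)$ is the minimum cardinality of a set $E'\subseteq E$ such that $\gamma(G-E')>\gamma(G)$, where $G-E'$ is obtained from $G$ by deleting the edges of $E'$ and keeping all vertices. *)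

theory Defs
  imports Main
begin

datatype 'a graph = Graph (verts: "'a set") (edges: "'a set set")

definition simple_graph :: "'a graph \<Rightarrow> bool" where
  "simple_graph G \<longleftrightarrow> finite (verts G) \<and> (\<forall>e\<in>edges G. e \<subseteq> verts G \<and> card e = 2)"

definition adjacent :: "'a graph \<Rightarrow> 'a \<Rightarrow> 'a \<Rightarrow> bool" where
  "adjacent G u v \<longleftrightarrow> {u, v} \<in> edges G"

definition path_graph :: "nat \<Rightarrow> nat graph" where
  "path_graph k = Graph {0..<k} {{i, i + 1} | i. i + 1 < k}"

definition strong_product :: "'a graph \<Rightarrow> 'b graph \<Rightarrow> ('a \<times> 'b) graph" (infixr "\<boxtimes>" 75) where
  "G \<boxtimes> H = Graph (verts G \<times> verts H)
     {{(v, u), (v', u')} | v u v' u'.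
        v \<in> verts G \<and> v' \<in> verts G \<and> u \<in> verts H \<and> u' \<in> verts H \<and>
        (v = v' \<and> adjacent H u u' \<or>
         adjacent G v v' \<and> u = u' \<or>
         adjacent G v v' \<and> adjacent H u u')}"

definition delete_edges :: "'a graph \<Rightarrow> 'a set set \<Rightarrow> 'a graph" where
  "delete_edges G F = Graph (verts G) (edges G - F)"

definition dominating :: "'a graph \<Rightarrow> 'a set \<Rightarrow> bool" where
  "dominating G D \<longleftrightarrow>
     D \<subseteq> verts G \<and> (\<forall>v\<in>verts G. v \<in> D \<or> (\<exists>u\<in>D. adjacent G v u))"

definition domination_number :: "'a graph \<Rightarrow> nat" where
  "domination_number G = (LEAST k. \<exists>D. dominating G D \<and> card D = k)"

text \<open>Only meaningful for a simple graph with at least one edge; then the minimum is over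
  a nonempty set.\<close>

definition bondage_number :: "'a graph \<Rightarrow> nat" where
  "bondage_number G =
     (LEAST k. \<exists>F. F \<subseteq> edges G \<and> card F = k \<and>
        domination_number (delete_edges G F) > domination_number G)"

lemma simple_graph_path_graph: "simple_graph (path_graph k)"
  by (auto simp: simple_graph_def path_graph_def)

lemma simple_graph_strong_product:
  assumes "simple_graph G" "simple_graph H"
  shows "simple_graph (G \<boxtimes> H)"
proof -
  have "u \<noteq> v" if "adjacent G u v" for u v
    using that assms(1) by (auto simp: simple_graph_def adjacent_def)
  moreover have "u \<noteq> v" if "adjacent H u v" for u v
    using that assms(2) by (auto simp: simple_graph_def adjacent_def)
  ultimately show ?thesis
    using assms by (fastforce simp: simple_graph_def strong_product_def card_2_iff)
qed

lemma adjacent_strong_product: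
  "adjacent (G \<boxtimes> H) (v, u) (v', u') \<longleftrightarrow>
     v \<in> verts G \<and> v' \<in> verts G \<and> u \<in> verts H \<and> u' \<in> verts H \<and>
     (v = v' \<and> adjacent H u u' \<or>
      adjacent G v v' \<and> u = u' \<or>
      adjacent G v v' \<and> adjacent H u u')"
  unfolding strong_product_def adjacent_def
  by (auto simp: doubleton_eq_iff insert_commute)

lemma bondage_set_exists:
  assumes G: "simple_graph G" and E: "edges G \<noteq> {}"
  shows "\<exists>F\<subseteq>edges G. domination_number (delete_edges G F) > domination_number G"
proof -
  obtain e where e: "e \<in> edges G" using E by blast
  then obtain a b where ab: "e = {a, b}" "a \<noteq> b" "a \<in> verts G" "b \<in> verts G"
    using G unfolding simple_graph_def by (metis card_2_iff insert_subset)
  have fin: "finite (verts G)" using G by (simp add: simple_graph_def)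
  have "dominating G (verts G - {a})"
    unfolding dominating_def adjacent_def using ab e by auto
  then have "domination_number G \<le> card (verts G - {a})"
    unfolding domination_number_def by (intro Least_le) blast
  also have "\<dots> < card (verts G)"
    using fin ab(3) by (rule card_Diff1_less)
  also have "dominating (delete_edges G (edges G)) D \<longleftrightarrow> D = verts G" for D
    by (auto simp: dominating_def delete_edges_def adjacent_def)
  then have "card (verts G) = domination_number (delete_edges G (edges G))"
    unfolding domination_number_def by (simp add: Least_equality)
  finally show ?thesis by blast
qed

end

theory Submission
  imports Defs
begin

text \<open>
  Number the rows \<open>0, ..., 3t\<close> and the columns \<open>0, ..., 3r + 1\<close>. A vertex of the grid dominates
  the vertices of a \<open>3 \<times> 3\<close> block around it, so the \<open>(t + 1)(r + 1)\<close> vertices with row \<open>3i\<close> and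
  column \<open>3k + 1\<close> need different dominators, whichever edges are deleted; products of a row set
  with a column set show that this many vertices also suffice (\<open>domination_number_grid\<close>).

  The corner \<open>(0, 0)\<close> has degree three and is not in this packing. Deleting its edges
  isolates it, and it can be added to the packing. So three edges are enough
  (\<open>domination_number_corner_deleted\<close>).

  That two edges are not enough is an averaging argument. Fix ten products \<open>A \<times> C\<close>: five row sets
  \<open>A\<close> of size at most \<open>t + 1\<close> (two of which coincide if \<open>t = 1\<close>), and two column sets \<open>C\<close> of size \<open>r + 1\<close>. Each product dominates the
  grid. If it stops doing so after edges are deleted, some vertex has lost all its dominators.
  A deleted edge is charged \<open>2\<close> when it leads to the only dominator of a vertex and \<open>1\<close> when it
  leads to one of several, so in total the deleted edges are charged at least \<open>2\<close>
  (\<open>cost_of_failure\<close>). Give the five row sets the weights \<open>3, 1, 1, 2, 2\<close>. With the two choices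
  of \<open>C\<close> the total weight is \<open>18\<close>, so if all products fail then the weighted charge is at least
  \<open>36\<close>. But one edge collects at most \<open>17\<close> over the whole family (\<open>weighted_cost\<close>), so two
  deleted edges collect at most \<open>34\<close>, and one of the products survives.

  In fact the charge is made according to rows: a dominator counts as the only one if no other row
  of \<open>A\<close> would do. An edge is charged only when \<open>C\<close> contains the column of its dominating end,
  and the two sets \<open>C\<close> are disjoint, so summing over \<open>C\<close> leaves a statement about dominating a
  path by row sets (\<open>weighted_load\<close>).
\<close>

section \<open>Packings and the domination number\<close>

lemma domination_number_le_card:
  assumes "dominating G D"
  shows "domination_number G \<le> card D"
  using assms unfolding domination_number_def by (blast intro: Least_le)

lemma packing_le_domination_number:
  assumes fin: "finite (verts G)" and S: "S \<subseteq> verts G"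
    and packing: "\<And>u v w. v \<in> S \<Longrightarrow> w \<in> S \<Longrightarrow> u = v \<or> adjacent G v u \<Longrightarrow>
      u = w \<or> adjacent G w u \<Longrightarrow> v = w"
  shows "card S \<le> domination_number G"
proof -
  have "dominating G (verts G)" by (simp add: dominating_def)
  then have "\<exists>D. dominating G D \<and> card D = domination_number G"
    unfolding domination_number_def
    using LeastI_ex[of "\<lambda>k. \<exists>D. dominating G D \<and> card D = k"] by blast
  then obtain D where D: "dominating G D" and card_D: "card D = domination_number G"
    by blast
  have "\<forall>v\<in>S. \<exists>u\<in>D. u = v \<or> adjacent G v u"
    using D S unfolding dominating_def by blast
  then obtain f where f: "\<forall>v\<in>S. f v \<in> D \<and> (f v = v \<or> adjacent G v (f v))"
    by metis
  have "inj_on f S"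
    using f packing by (metis inj_onI)
  moreover have "f ` S \<subseteq> D" using f by blast
  moreover have "finite D"
    using D fin unfolding dominating_def by (blast intro: finite_subset)
  ultimately have "card S \<le> card D" by (rule card_inj_on_le)
  then show ?thesis using card_D by simp
qed

section \<open>The strong grid\<close>

text \<open>Closed neighbourhoods of a path; those of the grid are products of two of them.\<close>

abbreviation near :: "nat \<Rightarrow> nat \<Rightarrow> bool" where
  "near x y \<equiv> x \<le> y + 1 \<and> y \<le> x + 1"

lemma adjacent_path_graph:
  "adjacent (path_graph k) x y \<longleftrightarrow> x < k \<and> y < k \<and> near x y \<and> x \<noteq> y"
proof -
  have "{x, y} = {i, i + 1} \<longleftrightarrow> x = i \<and> y = i + 1 \<or> x = i + 1 \<and> y = i" for i
    by (auto simp: doubleton_eq_iff)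
  then have "adjacent (path_graph k) x y \<longleftrightarrow> y = x + 1 \<and> x + 1 < k \<or> x = y + 1 \<and> y + 1 < k"
    unfolding adjacent_def path_graph_def graph.sel mem_Collect_eq by auto
  then show ?thesis by auto
qed

lemma verts_grid [simp]: "verts (path_graph n \<boxtimes> path_graph m) = {..<n} \<times> {..<m}"
  by (auto simp: strong_product_def path_graph_def)

lemma adjacent_grid:
  "adjacent (path_graph n \<boxtimes> path_graph m) (x, y) (x', y') \<longleftrightarrow>
     x < n \<and> x' < n \<and> y < m \<and> y' < m \<and> near x x' \<and> near y y' \<and> (x, y) \<noteq> (x', y')"
  unfolding adjacent_strong_product adjacent_path_graph
  by (auto simp: path_graph_def)

lemma adjacent_grid_near:
  assumes "adjacent (path_graph n \<boxtimes> path_graph m) v u"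
  shows "near (fst v) (fst u) \<and> near (snd v) (snd u)"
  using assms adjacent_grid[of n m "fst v" "snd v" "fst u" "snd u"] by simp

lemma edge_grid_cases:
  assumes "e \<in> edges (path_graph n \<boxtimes> path_graph m)"
  obtains x y x' y' where "e = {(x, y), (x', y')}" "x < n" "x' < n" "near x x'"
    "(x, y) \<noteq> (x', y')"
proof -
  obtain p q where pq: "e = {p, q}"
    using assms unfolding strong_product_def by auto
  obtain x y x' y' where "p = (x, y)" "q = (x', y')" by fastforce
  moreover have "adjacent (path_graph n \<boxtimes> path_graph m) p q"
    using assms pq by (simp add: adjacent_def)
  ultimately show thesis
    using that pq adjacent_grid by metis
qed

lemma finite_edges_grid: "finite (edges (path_graph n \<boxtimes> path_graph m))"
proof (rule finite_subset)
  show "edges (path_graph n \<boxtimes> path_graph m) \<subseteq> Pow (verts (path_graph n \<boxtimes> path_graph m))"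
    using simple_graph_strong_product[OF simple_graph_path_graph simple_graph_path_graph]
    unfolding simple_graph_def by blast
qed simp

text \<open>
  Rows and columns are spaced three apart, so that no vertex is near two members. The columns
  start at \<open>1\<close> so that the corner is not a member and can be added once it is isolated.
\<close>

definition grid_packing :: "nat \<Rightarrow> nat \<Rightarrow> (nat \<times> nat) set" where
  "grid_packing t r = (\<lambda>(i, k). (3 * i, 3 * k + 1)) ` ({..t} \<times> {..r})"

lemma card_grid_packing: "card (grid_packing t r) = (t + 1) * (r + 1)"
  unfolding grid_packing_def
  by (subst card_image) (auto simp: inj_on_def card_cartesian_product)

lemma grid_packing_subset: "grid_packing t r \<subseteq> {..<3 * t + 1} \<times> {..<3 * r + 2}"
  by (auto simp: grid_packing_def)

lemma grid_packing_far:
  assumes "v \<in> grid_packing t r" "w \<in> grid_packing t r"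
    and "u = v \<or> adjacent (path_graph n \<boxtimes> path_graph m) v u"
    and "u = w \<or> adjacent (path_graph n \<boxtimes> path_graph m) w u"
  shows "v = w"
proof -
  obtain i k where v: "v = (3 * i, 3 * k + 1)" using assms(1) by (auto simp: grid_packing_def)
  obtain i' k' where w: "w = (3 * i', 3 * k' + 1)" using assms(2) by (auto simp: grid_packing_def)
  have "near (fst v) (fst u)" "near (snd v) (snd u)" "near (fst w) (fst u)" "near (snd w) (snd u)"
    using adjacent_grid_near[of n m v u] adjacent_grid_near[of n m w u] assms(3,4) by auto
  then have "i = i'" "k = k'" unfolding v w fst_conv snd_conv by linarith+
  then show ?thesis by (simp add: v w)
qed

lemma domination_number_grid_ge:
  "(t + 1) * (r + 1) \<le> domination_number (path_graph (3 * t + 1) \<boxtimes> path_graph (3 * r + 2))"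
proof -
  have "card (grid_packing t r)
      \<le> domination_number (path_graph (3 * t + 1) \<boxtimes> path_graph (3 * r + 2))"
  proof (rule packing_le_domination_number)
    show "grid_packing t r \<subseteq> verts (path_graph (3 * t + 1) \<boxtimes> path_graph (3 * r + 2))"
      by (simp only: verts_grid grid_packing_subset)
  qed (use grid_packing_far in \<open>simp, blast\<close>)
  then show ?thesis by (simp add: card_grid_packing)
qed

section \<open>Isolating a corner\<close>

definition corner_edges :: "(nat \<times> nat) set set" where
  "corner_edges = {{(0, 0), (0, 1)}, {(0, 0), (1, 0)}, {(0, 0), (1, 1)}}"

lemma card_corner_edges: "card corner_edges = 3"
  by (simp add: corner_edges_def doubleton_eq_iff)

lemma corner_edges_subset:
  assumes "2 \<le> n" "2 \<le> m"
  shows "corner_edges \<subseteq> edges (path_graph n \<boxtimes> path_graph m)"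
proof -
  have "adjacent (path_graph n \<boxtimes> path_graph m) (0, 0) p" if "p \<in> {(0, 1), (1, 0), (1, 1)}" for p
    using that assms by (auto simp: adjacent_grid)
  then show ?thesis by (simp add: corner_edges_def adjacent_def)
qed

lemma adjacent_delete_edges:
  "adjacent (delete_edges G F) u v \<longleftrightarrow> adjacent G u v \<and> {u, v} \<notin> F"
  by (simp add: adjacent_def delete_edges_def)

lemma corner_isolated:
  "\<not> adjacent (delete_edges (path_graph n \<boxtimes> path_graph m) corner_edges) (0, 0) u"
proof
  obtain x y where u: "u = (x, y)" by fastforce
  assume "adjacent (delete_edges (path_graph n \<boxtimes> path_graph m) corner_edges) (0, 0) u"
  then have a: "x \<le> 1" "y \<le> 1" "(x, y) \<noteq> (0, 0)" "{(0, 0), (x, y)} \<notin> corner_edges"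
    by (auto simp: u adjacent_delete_edges adjacent_grid)
  then have "(x, y) \<in> {(0, 1), (1, 0), (1, 1)}" by auto
  then show False using a(4) by (auto simp: corner_edges_def)
qed

text \<open>
  Deleting edges keeps a packing a packing, and an isolated corner shares its closed neighbourhood
  with nothing, so the packing grows by one.
\<close>

lemma domination_number_corner_deleted:
  "(t + 1) * (r + 1) <
     domination_number (delete_edges (path_graph (3 * t + 1) \<boxtimes> path_graph (3 * r + 2)) corner_edges)"
  (is "_ < domination_number ?H")
proof -
  have sym: "adjacent ?H u v \<longleftrightarrow> adjacent ?H v u" for u v
    by (simp add: adjacent_def insert_commute)
  have "card (insert (0, 0) (grid_packing t r)) \<le> domination_number ?H"
  proof (rule packing_le_domination_number)
    show "finite (verts ?H)" "insert (0, 0) (grid_packing t r) \<subseteq> verts ?H"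
      using grid_packing_subset by (auto simp: delete_edges_def)
    fix u v w
    assume *: "v \<in> insert (0, 0) (grid_packing t r)" "w \<in> insert (0, 0) (grid_packing t r)"
      "u = v \<or> adjacent ?H v u" "u = w \<or> adjacent ?H w u"
    show "v = w"
    proof (cases "v = (0, 0) \<or> w = (0, 0)")
      case True
      then show ?thesis using * corner_isolated sym by metis
    next
      case False
      with * show ?thesis
        using grid_packing_far by (metis adjacent_delete_edges insert_iff)
    qed
  qed
  moreover have "(0, 0) \<notin> grid_packing t r" "finite (grid_packing t r)"
    by (auto simp: grid_packing_def)
  ultimately show ?thesis by (simp add: card_grid_packing)
qed

section \<open>When a product set fails to dominate\<close>

text \<open>
  How much a row set \<open>A\<close> relies on \<open>x\<close> to dominate \<open>x'\<close>, measured in halves: a sole dominator carries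
  the whole load and one of several carries half of it. So however many dominators \<open>x'\<close> has, their
  loads add up to at least \<open>2\<close>.
\<close>

definition load :: "nat set \<Rightarrow> nat \<Rightarrow> nat \<Rightarrow> nat" where
  "load A x x' =
     (if x \<in> A \<and> near x x' then (if \<forall>z\<in>A. near z x' \<longrightarrow> z = x then 2 else 1) else 0)"

lemma load_le_2: "load A x x' \<le> 2"
  by (simp add: load_def)

lemma load_notin: "x \<notin> A \<Longrightarrow> load A x x' = 0"
  by (simp add: load_def)

lemma load_shared: "z \<in> A \<Longrightarrow> near z x' \<Longrightarrow> z \<noteq> x \<Longrightarrow> load A x x' \<le> 1"
  by (auto simp: load_def)

lemma load_private:
  assumes "x \<in> A" "near x x'" "\<forall>z\<in>A. near z x' \<longrightarrow> z = x"
  shows "load A x x' = 2"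
  unfolding load_def by (rule trans[OF if_P if_P]; use assms in blast)

text \<open>
  For an edge with ends \<open>(x, y)\<close> and \<open>(x', y')\<close>, this adds the loads of its two
  orientations, each only if its dominating end lies in a column of \<open>C\<close>. An orientation is counted
  even if its other end belongs to \<open>A \<times> C\<close>; this only increases the cost and lets it depend on rows
  through \<open>load\<close> alone.
\<close>

definition cost :: "nat set \<Rightarrow> nat set \<Rightarrow> (nat \<times> nat) set \<Rightarrow> nat" where
  "cost A C e = (\<Sum>u\<in>e. \<Sum>v\<in>e - {u}. if snd u \<in> C then load A (fst u) (fst v) else 0)"

lemma cost_edge:
  assumes "(x, y) \<noteq> (x', y')"
  shows "cost A C {(x, y), (x', y')} =
    (if y \<in> C then load A x x' else 0) + (if y' \<in> C then load A x' x else 0)"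
proof -
  have "{(x, y), (x', y')} - {(x, y)} = {(x', y')}" "{(x, y), (x', y')} - {(x', y')} = {(x, y)}"
    using assms by auto
  then show ?thesis using assms by (simp add: cost_def)
qed

text \<open>
  A vertex \<open>(x, y)\<close> that is no longer dominated lies outside \<open>A \<times> C\<close>. For a column \<open>c\<close> of \<open>C\<close> near
  \<open>y\<close>, every row of \<open>A\<close> near \<open>x\<close> gives a former dominator in column \<open>c\<close>, so the edge to it has been
  deleted. Either there is one such row, whose edge costs \<open>2\<close>, or there are two, whose edges are
  different and cost at least \<open>1\<close> each.
\<close>

lemma cost_of_failure:
  assumes A: "A \<subseteq> {..<n}" "\<forall>x<n. \<exists>a\<in>A. near a x"
    and C: "C \<subseteq> {..<m}" "\<forall>y<m. \<exists>c\<in>C. near c y"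
    and F: "finite F"
    and fails: "\<not> dominating (delete_edges (path_graph n \<boxtimes> path_graph m) F) (A \<times> C)"
  shows "2 \<le> (\<Sum>e\<in>F. cost A C e)"
proof -
  obtain x y where v: "x < n" "y < m" "(x, y) \<notin> A \<times> C"
    and undominated: "\<And>u. u \<in> A \<times> C \<Longrightarrow>
      \<not> adjacent (delete_edges (path_graph n \<boxtimes> path_graph m) F) (x, y) u"
    using fails A(1) C(1) unfolding dominating_def by (auto simp: delete_edges_def)
  obtain c where c: "c \<in> C" "near c y" using C v by blast
  obtain a where a: "a \<in> A" "near a x" using A v by blast
  have deleted: "{(z, c), (x, y)} \<in> F" and cost_ge: "load A z x \<le> cost A C {(z, c), (x, y)}"
    if "z \<in> A" "near z x" for z
  proof -
    have ne: "(z, c) \<noteq> (x, y)" using that(1) c(1) v(3) by auto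
    have "z < n" "c < m" using that A C c by auto
    with ne have "adjacent (path_graph n \<boxtimes> path_graph m) (x, y) (z, c)"
      using that v c by (auto simp: adjacent_grid)
    then show "{(z, c), (x, y)} \<in> F"
      using undominated[of "(z, c)"] that(1) c(1)
      by (auto simp: adjacent_delete_edges insert_commute)
    show "load A z x \<le> cost A C {(z, c), (x, y)}"
      using c(1) by (simp add: cost_edge[OF ne])
  qed
  show ?thesis
  proof (cases "\<forall>z\<in>A. near z x \<longrightarrow> z = a")
    case True
    then have "2 = load A a x" using load_private a by metis
    also have "\<dots> \<le> cost A C {(a, c), (x, y)}" using cost_ge a by blast
    also have "\<dots> \<le> (\<Sum>e\<in>F. cost A C e)"
      using F deleted[OF a] by (intro member_le_sum) auto
    finally show ?thesis .
  next
    case False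
    then obtain b where b: "b \<in> A" "near b x" "b \<noteq> a" by blast
    have "{(a, c), (x, y)} \<noteq> {(b, c), (x, y)}"
      using b(3) by (auto simp: doubleton_eq_iff)
    then have "cost A C {(a, c), (x, y)} + cost A C {(b, c), (x, y)}
        = (\<Sum>e\<in>{{(a, c), (x, y)}, {(b, c), (x, y)}}. cost A C e)" by simp
    also have "\<dots> \<le> (\<Sum>e\<in>F. cost A C e)"
      using F deleted[OF a] deleted[OF b(1,2)] by (intro sum_mono2) auto
    finally have "cost A C {(a, c), (x, y)} + cost A C {(b, c), (x, y)} \<le> (\<Sum>e\<in>F. cost A C e)" .
    moreover have "1 \<le> load A a x" "1 \<le> load A b x"
      using a b by (auto simp: load_def)
    ultimately show ?thesis
      using cost_ge[OF a] cost_ge[OF b(1,2)] by linarith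
  qed
qed

section \<open>A weighted family of row sets\<close>

lemma mod_3_cases:
  fixes x :: nat
  obtains "x mod 3 = 0" | "x mod 3 = 1" | "x mod 3 = 2"
proof -
  have "x mod 3 = 0 \<or> x mod 3 = 1 \<or> x mod 3 = 2" by presburger
  then show thesis using that by (elim disjE)
qed

lemma pred_mod_3:
  "(x - 1) mod 3 = (if x = 0 then 0 else if x mod 3 = 0 then 2 else x mod 3 - (1 :: nat))"
  by (cases x) (auto simp: mod_Suc)

text \<open>
  Every \<open>t + 1\<close> rows dominating the path \<open>0, ..., 3t\<close> have the form \<open>3i + s\<^sub>i\<close>, where the shifts
  \<open>s\<^sub>i\<close> from \<open>{-1, 0, 1}\<close> do not increase with \<open>i\<close>, the first is not \<open>-1\<close> and the last is not \<open>1\<close>.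
  The family uses the shift sequences \<open>(0, ..., 0)\<close>, \<open>(0, -1, ..., -1)\<close>, \<open>(1, ..., 1, 0)\<close>,
  \<open>(1, -1, ..., -1)\<close> and \<open>(1, ..., 1, -1)\<close>, in this order.
\<close>

definition residue_rows :: "nat \<Rightarrow> nat \<Rightarrow> nat set" where
  "residue_rows t s = {x. x \<le> 3 * t \<and> x mod 3 = s}"

definition row_sets :: "nat \<Rightarrow> nat set set" where
  "row_sets t = {residue_rows t 0,
     insert 0 (residue_rows t 2), insert (3 * t) (residue_rows t 1),
     insert 1 (residue_rows t 2), insert (3 * t - 1) (residue_rows t 1)}"

text \<open>
  The weights are a solution of a small system of inequalities. Let \<open>a\<close> be the weight of
  the shift sequence \<open>(0, ..., 0)\<close>, \<open>c\<close> that of each of the next two, and \<open>b\<close> that of each of the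
  last two. Then \<open>a + 2c + 2b\<close> is
  the total. Row \<open>0\<close> is in the first two sets, and row \<open>1\<close> is sole dominator of itself in the third
  and (if \<open>t > 1\<close>) the fifth and shares this in the fourth. Edges inside one row, whose two ends may
  take turns in being the dominator as \<open>C\<close> changes, force both \<open>a + c\<close> and \<open>c + 3b/2\<close> below half
  of the total, that is, \<open>b < a < 2b\<close>; edges between consecutive rows need \<open>c > 0\<close>.
\<close>

definition weighted_sum :: "nat \<Rightarrow> (nat set \<Rightarrow> nat) \<Rightarrow> nat" where
  "weighted_sum t f = 3 * f (residue_rows t 0)
     + f (insert 0 (residue_rows t 2)) + f (insert (3 * t) (residue_rows t 1))
     + 2 * f (insert 1 (residue_rows t 2)) + 2 * f (insert (3 * t - 1) (residue_rows t 1))"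

lemma weighted_sum_sum: "weighted_sum t (\<lambda>A. \<Sum>e\<in>F. f e A) = (\<Sum>e\<in>F. weighted_sum t (f e))"
  by (simp add: weighted_sum_def sum.distrib sum_distrib_left)

lemma weighted_sum_mono:
  "(\<And>A. A \<in> row_sets t \<Longrightarrow> f A \<le> g A) \<Longrightarrow> weighted_sum t f \<le> weighted_sum t g"
  by (simp add: weighted_sum_def row_sets_def add_mono)

lemma weighted_sum_const: "weighted_sum t (\<lambda>A. k) = 9 * k"
  by (simp add: weighted_sum_def)

lemma row_sets_subset: "1 \<le> t \<Longrightarrow> A \<in> row_sets t \<Longrightarrow> A \<subseteq> {..<3 * t + 1}"
  by (auto simp: row_sets_def residue_rows_def)

lemma row_sets_cover:
  assumes t: "1 \<le> t" and A: "A \<in> row_sets t" and x: "x < 3 * t + 1"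
  shows "\<exists>a\<in>A. near a x"
proof -
  have "x - 1 \<in> A \<or> x \<in> A \<or> x + 1 \<in> A"
  proof -
    show ?thesis
    proof (cases x rule: mod_3_cases)
      case 1
      have "(x + 1) mod 3 = 1" "x = 0 \<or> (x - 1) mod 3 = 2" "x = 3 * t \<or> x + 1 \<le> 3 * t"
        using 1 x pred_mod_3[of x] by (auto simp: mod_Suc)
      then show ?thesis
        using A 1 x unfolding row_sets_def residue_rows_def by (elim insertE emptyE) auto
    next
      case 2
      have "x \<noteq> 3 * t" using 2 by auto
      then have "(x + 1) mod 3 = 2" "(x - 1) mod 3 = 0" "x + 1 \<le> 3 * t"
        using 2 x pred_mod_3[of x] by (auto simp: mod_Suc)
      then show ?thesis
        using A 2 unfolding row_sets_def residue_rows_def by (elim insertE emptyE) auto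
    next
      case 3
      have "x \<noteq> 3 * t" using 3 by auto
      then have "(x + 1) mod 3 = 0" "(x - 1) mod 3 = 1" "x + 1 \<le> 3 * t"
        using 3 x pred_mod_3[of x] by (auto simp: mod_Suc)
      then show ?thesis
        using A 3 unfolding row_sets_def residue_rows_def by (elim insertE emptyE) auto
    qed
  qed
  then show ?thesis
  proof (elim disjE)
    assume "x - 1 \<in> A"
    then show ?thesis by (intro bexI[of _ "x - 1"]) auto
  next
    assume "x + 1 \<in> A"
    then show ?thesis by (intro bexI[of _ "x + 1"]) auto
  next
    assume "x \<in> A"
    then show ?thesis by (intro bexI[of _ x]) auto
  qed
qed

lemma card_row_sets:
  assumes "A \<in> row_sets t"
  shows "card A \<le> t + 1"
proof -
  have image: "residue_rows t s \<subseteq> (\<lambda>i. 3 * i + s) ` {i. 3 * i + s \<le> 3 * t}" for s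
  proof
    fix x assume "x \<in> residue_rows t s"
    then have "x = 3 * (x div 3) + s" "x \<le> 3 * t" by (auto simp: residue_rows_def)
    then show "x \<in> (\<lambda>i. 3 * i + s) ` {i. 3 * i + s \<le> 3 * t}" by auto
  qed
  have "{i. 3 * i + 0 \<le> 3 * t} = {..t}" by auto
  then have 0: "card (residue_rows t 0) \<le> t + 1"
    using surj_card_le[OF _ image[of 0]] by simp
  have "card (insert x (residue_rows t s)) \<le> t + 1" if "s = 1 \<or> s = 2" for x s
  proof -
    have "{i. 3 * i + s \<le> 3 * t} = {..<t}" using that by auto
    then have "card (residue_rows t s) \<le> t"
      using surj_card_le[OF _ image[of s]] by simp
    then show ?thesis
      by (metis add.commute card_insert_le_m1 diff_add_inverse le_add1 zero_less_one trans_less_add1)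
  qed
  then show ?thesis using assms 0 unfolding row_sets_def by auto
qed

lemma load_pair_le_2: "load A x (x + 1) + load A (x + 1) x \<le> 2"
proof -
  consider "x \<notin> A" | "x + 1 \<notin> A" | "x \<in> A" "x + 1 \<in> A" by blast
  then show ?thesis
  proof cases
    case 3
    then have "load A x (x + 1) \<le> 1" "load A (x + 1) x \<le> 1"
      using load_shared[of "x + 1" A "x + 1" x] load_shared[of x A x "x + 1"] by simp_all
    then show ?thesis by simp
  qed (simp_all add: load_notin load_le_2)
qed

text \<open>
  Only row sets that contain \<open>x\<close> contribute, each at most twice its weight, and half of that if
  a neighbour of \<open>x\<close> is also in the set. All residues of \<open>x\<close> give the bound \<open>8\<close>:
  \<open>2 * 3 + 2\<close> for a multiple of three, as \<open>0\<close> and \<open>3t\<close> are different and each is in one of the sets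
  of weight \<open>1\<close>; and \<open>2 + 2 * 2 + 2\<close> for the others, where the last term is the half load of
  the exceptional rows \<open>1\<close> and \<open>3t - 1\<close>.
\<close>

lemma weighted_load_same_row:
  assumes t: "1 \<le> t" and x: "x \<le> 3 * t"
  shows "weighted_sum t (\<lambda>A. load A x x) \<le> 8"
proof -
  note [simp] = residue_rows_def load_notin
  have le: "load A x x \<le> 2" for A by (rule load_le_2)
  show ?thesis
  proof (cases x rule: mod_3_cases)
    case 1
    have "load (insert 0 (residue_rows t 2)) x x + load (insert (3 * t) (residue_rows t 1)) x x \<le> 2"
    proof (cases "x = 0")
      case True
      then have "load (insert (3 * t) (residue_rows t 1)) x x = 0" using t by simp
      then show ?thesis using le by simp
    next
      case False
      then have "load (insert 0 (residue_rows t 2)) x x = 0" using 1 by simp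
      then show ?thesis using le by simp
    qed
    moreover have "load (insert 1 (residue_rows t 2)) x x = 0"
      using 1 by (intro load_notin) auto
    moreover have "load (insert (3 * t - 1) (residue_rows t 1)) x x = 0"
    proof (rule load_notin)
      have "(3 * t - 1) mod 3 = 2" using t pred_mod_3[of "3 * t"] by simp
      then show "x \<notin> insert (3 * t - 1) (residue_rows t 1)" using 1 by auto
    qed
    ultimately show ?thesis using le[of "residue_rows t 0"] by (simp only: weighted_sum_def)
  next
    case 2
    have "load (insert 1 (residue_rows t 2)) x x \<le> 1"
    proof (cases "x = 1")
      case True
      show ?thesis by (rule load_shared[of 2]) (use True t in auto)
    next
      case False
      then show ?thesis using 2 by simp
    qed
    moreover have "load (residue_rows t 0) x x = 0" "load (insert 0 (residue_rows t 2)) x x = 0"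
      using 2 by (auto intro!: load_notin)
    ultimately show ?thesis
      using le[of "insert (3 * t) (residue_rows t 1)"] le[of "insert (3 * t - 1) (residue_rows t 1)"]
      by (simp only: weighted_sum_def)
  next
    case 3
    have "load (insert (3 * t - 1) (residue_rows t 1)) x x \<le> 1"
    proof (cases "x = 3 * t - 1")
      case True
      have "(3 * t - 2) mod 3 = 1"
        using t pred_mod_3[of "3 * t"] pred_mod_3[of "3 * t - 1"] by (simp add: numeral_2_eq_2)
      then show ?thesis by (intro load_shared[of "3 * t - 2"]) (use True t in auto)
    next
      case False
      then show ?thesis using 3 by simp
    qed
    moreover have "load (residue_rows t 0) x x = 0" using 3 by simp
    moreover have "load (insert (3 * t) (residue_rows t 1)) x x = 0"
      using 3 by (intro load_notin) auto
    ultimately show ?thesis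
      using le[of "insert 0 (residue_rows t 2)"] le[of "insert 1 (residue_rows t 2)"]
      by (simp only: weighted_sum_def)
  qed
qed

text \<open>
  Each row set contributes at most twice its weight, which would give \<open>18\<close>. One unit is saved
  because some member of the family does not need the pair fully: it either
  contains neither row, or contains one of them and provides the other with a second dominator.
\<close>

lemma weighted_load_adjacent_rows:
  assumes t: "1 \<le> t" and x: "x + 1 \<le> 3 * t"
  shows "weighted_sum t (\<lambda>A. load A x (x + 1) + load A (x + 1) x) \<le> 17"
proof -
  let ?p = "\<lambda>A. load A x (x + 1) + load A (x + 1) x"
  have le: "?p A \<le> 2" for A by (rule load_pair_le_2)
  have "?p (residue_rows t 0) \<le> 1 \<or> ?p (insert 0 (residue_rows t 2)) \<le> 1 \<or>
      ?p (insert (3 * t) (residue_rows t 1)) \<le> 1"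
  proof -
    show ?thesis
    proof (cases x rule: mod_3_cases)
      case 1
      let ?A = "insert 0 (residue_rows t 2)"
      have "(x + 1) mod 3 = 1" "(x + 2) mod 3 = 2" using 1 by (auto simp: mod_Suc)
      moreover from this have "x + 1 \<noteq> 3 * t" by auto
      then have "x + 2 \<le> 3 * t" using x by simp
      ultimately have "x + 1 \<notin> ?A" "x + 2 \<in> ?A"
        by (simp_all add: residue_rows_def)
      then have "load ?A (x + 1) x = 0" "load ?A x (x + 1) \<le> 1"
        using load_notin load_shared[of "x + 2" ?A "x + 1" x] by simp_all
      then show ?thesis by simp
    next
      case 2
      then have "(x + 1) mod 3 = 2" by (simp add: mod_Suc)
      with 2 have "?p (residue_rows t 0) = 0"
        by (simp add: load_notin residue_rows_def)
      then show ?thesis by simp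
    next
      case 3
      let ?A = "insert (3 * t) (residue_rows t 1)"
      have "x \<noteq> 0" using 3 by auto
      then have "(x - 1) mod 3 = 1" "1 \<le> x" using 3 pred_mod_3[of x] by simp_all
      then have "x \<notin> ?A" "x - 1 \<in> ?A" "near (x - 1) x"
        using x 3 by (auto simp: residue_rows_def)
      then have "load ?A x (x + 1) = 0" "load ?A (x + 1) x \<le> 1"
        using load_notin load_shared[of "x - 1" ?A x "x + 1"] by simp_all
      then show ?thesis by simp
    qed
  qed
  moreover have "3 * a + b + c + 2 * d + 2 * e \<le> 17"
    if "a \<le> 1 \<or> b \<le> 1 \<or> c \<le> 1" "a \<le> 2" "b \<le> 2" "c \<le> 2" "d \<le> 2" "e \<le> 2" for a b c d e :: nat
    using that by linarith
  ultimately show ?thesis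
    unfolding weighted_sum_def using le by blast
qed

text \<open>For \<open>x = x'\<close> both orientations are the same, and the bound \<open>8\<close> doubles to \<open>16\<close>.\<close>

lemma weighted_load:
  assumes t: "1 \<le> t" and x: "x \<le> 3 * t" "x' \<le> 3 * t" "near x x'"
  shows "weighted_sum t (\<lambda>A. load A x x' + load A x' x) \<le> 17"
proof -
  consider "x' = x" | "x' = x + 1" | "x = x' + 1" using x by linarith
  then show ?thesis
  proof cases
    case 1
    have "weighted_sum t (\<lambda>A. load A x x + load A x x) = 2 * weighted_sum t (\<lambda>A. load A x x)"
      by (simp add: weighted_sum_def)
    then show ?thesis using 1 weighted_load_same_row[OF t x(1)] by simp
  next
    case 2
    then show ?thesis using weighted_load_adjacent_rows[OF t, of x] x by simp
  next
    case 3
    then show ?thesis using weighted_load_adjacent_rows[OF t, of x'] x by (simp add: add.commute)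
  qed
qed

section \<open>Two deleted edges\<close>

text \<open>
  The column sets for the shifts \<open>0\<close> and \<open>1\<close>; \<open>3r + 2\<close> columns leave room for just these two
  shifts of the period.
\<close>

definition columns :: "nat \<Rightarrow> nat \<Rightarrow> nat set" where
  "columns r s = (\<lambda>k. 3 * k + s) ` {..r}"

lemma columns_subset: "s \<le> 1 \<Longrightarrow> columns r s \<subseteq> {..<3 * r + 2}"
  by (auto simp: columns_def)

lemma columns_cover:
  assumes "s \<le> 1" "y < 3 * r + 2"
  shows "\<exists>c\<in>columns r s. near c y"
proof -
  define k where "k = (y + 1 - s) div 3"
  have "y + 1 - s = 3 * k + (y + 1 - s) mod 3" "(y + 1 - s) mod 3 < 3"
    by (simp_all add: k_def)
  then have "k \<le> r" "near (3 * k + s) y" using assms by linarith+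
  then show ?thesis unfolding columns_def by blast
qed

lemma card_columns: "card (columns r s) = r + 1"
  by (simp add: columns_def card_image inj_on_def)

lemma columns_disjoint: "columns r 0 \<inter> columns r 1 = {}"
proof -
  have "c mod 3 = s" if "c \<in> columns r s" "s \<le> 1" for c s
    using that by (auto simp: columns_def)
  from this[of _ 0] this[of _ 1] show ?thesis by fastforce
qed

text \<open>
  Each end of an edge lies in at most one of the two column sets, so over both of them each
  orientation is charged at most once.
\<close>

lemma weighted_cost:
  assumes t: "1 \<le> t"
    and e: "e \<in> edges (path_graph (3 * t + 1) \<boxtimes> path_graph (3 * r + 2))"
  shows "weighted_sum t (\<lambda>A. cost A (columns r 0) e + cost A (columns r 1) e) \<le> 17"
proof -
  obtain x y x' y' where xy: "e = {(x, y), (x', y')}" "x < 3 * t + 1" "x' < 3 * t + 1"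
    "near x x'" "(x, y) \<noteq> (x', y')"
    using edge_grid_cases[OF e] by metis
  have "cost A (columns r 0) e + cost A (columns r 1) e \<le> load A x x' + load A x' x" for A
    using columns_disjoint[of r] unfolding xy(1) cost_edge[OF xy(5)] by auto
  then have "weighted_sum t (\<lambda>A. cost A (columns r 0) e + cost A (columns r 1) e)
      \<le> weighted_sum t (\<lambda>A. load A x x' + load A x' x)"
    by (intro weighted_sum_mono)
  also have "\<dots> \<le> 17" using weighted_load[OF t, of x x'] xy by simp
  finally show ?thesis .
qed

text \<open>
  If all members failed, the two column sets together would cost at least \<open>4\<close> for each row set,
  hence at least \<open>9 * 4 = 36\<close> in the weighted sum, but the edges pay at most \<open>2 * 17 = 34\<close>.
\<close>

lemma two_edges_deleted:
  assumes t: "1 \<le> t"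
    and F: "F \<subseteq> edges (path_graph (3 * t + 1) \<boxtimes> path_graph (3 * r + 2))" "card F \<le> 2"
  shows "\<exists>A\<in>row_sets t. \<exists>s\<le>1. dominating
    (delete_edges (path_graph (3 * t + 1) \<boxtimes> path_graph (3 * r + 2)) F) (A \<times> columns r s)"
proof (rule ccontr)
  assume fail: "\<not> ?thesis"
  have fin: "finite F" using F(1) finite_edges_grid by (rule finite_subset)
  have fails: "2 \<le> (\<Sum>e\<in>F. cost A (columns r s) e)" if "A \<in> row_sets t" "s \<le> 1" for A s
    using fail that fin row_sets_subset[OF t that(1)] row_sets_cover[OF t that(1)]
      columns_subset[OF that(2)] columns_cover[OF that(2)]
    by (intro cost_of_failure[where n = "3 * t + 1" and m = "3 * r + 2"]) auto
  have "4 \<le> (\<Sum>e\<in>F. cost A (columns r 0) e + cost A (columns r 1) e)"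
    if "A \<in> row_sets t" for A
    using fails[OF that, of 0] fails[OF that, of 1] by (simp add: sum.distrib)
  then have "weighted_sum t (\<lambda>A. 4)
      \<le> weighted_sum t (\<lambda>A. \<Sum>e\<in>F. cost A (columns r 0) e + cost A (columns r 1) e)"
    by (intro weighted_sum_mono)
  also have "\<dots> = (\<Sum>e\<in>F. weighted_sum t (\<lambda>A. cost A (columns r 0) e + cost A (columns r 1) e))"
    by (rule weighted_sum_sum)
  also have "\<dots> \<le> card F * 17"
    using weighted_cost[OF t] F(1) by (intro sum_bounded_above[where 'a = nat, simplified]) auto
  finally show False using F(2) by (simp add: weighted_sum_const)
qed

lemma domination_number_two_edges_deleted:
  assumes t: "1 \<le> t"
    and F: "F \<subseteq> edges (path_graph (3 * t + 1) \<boxtimes> path_graph (3 * r + 2))" "card F \<le> 2"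
  shows "domination_number (delete_edges (path_graph (3 * t + 1) \<boxtimes> path_graph (3 * r + 2)) F)
    \<le> (t + 1) * (r + 1)"
proof -
  obtain A s where A: "A \<in> row_sets t" and dom: "dominating
      (delete_edges (path_graph (3 * t + 1) \<boxtimes> path_graph (3 * r + 2)) F) (A \<times> columns r s)"
    using two_edges_deleted[OF t F] by blast
  have "card (A \<times> columns r s) \<le> (t + 1) * (r + 1)"
    using card_row_sets[OF A] by (simp only: card_cartesian_product card_columns mult_le_mono1)
  then show ?thesis using domination_number_le_card[OF dom] by linarith
qed

lemma domination_number_grid:
  assumes "1 \<le> t"
  shows "domination_number (path_graph (3 * t + 1) \<boxtimes> path_graph (3 * r + 2)) = (t + 1) * (r + 1)"
proof -
  have "delete_edges G {} = G" for G :: "(nat \<times> nat) graph"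
    by (simp add: delete_edges_def)
  then show ?thesis
    using domination_number_two_edges_deleted[OF assms, of "{}" r] domination_number_grid_ge[of t r]
    by simp
qed

theorem theorem7:
  fixes n m t r :: nat
  assumes "n \<ge> 2" and "m \<ge> 2"
    and "n = 3 * t + 1" and "m = 3 * r + 2"
  shows "bondage_number (path_graph n \<boxtimes> path_graph m) = 3"
proof -
  have t: "1 \<le> t" using assms(1,3) by simp
  note dom = domination_number_grid[OF t, of r]
  show ?thesis
    unfolding bondage_number_def
  proof (rule Least_equality)
    show "\<exists>F\<subseteq>edges (path_graph n \<boxtimes> path_graph m). card F = 3 \<and>
        domination_number (path_graph n \<boxtimes> path_graph m)
          < domination_number (delete_edges (path_graph n \<boxtimes> path_graph m) F)"
      using corner_edges_subset[OF assms(1,2)] card_corner_edges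
        domination_number_corner_deleted[of t r] dom assms(3,4) by metis
  next
    fix k
    assume "\<exists>F\<subseteq>edges (path_graph n \<boxtimes> path_graph m). card F = k \<and>
        domination_number (path_graph n \<boxtimes> path_graph m)
          < domination_number (delete_edges (path_graph n \<boxtimes> path_graph m) F)"
    then obtain F where "F \<subseteq> edges (path_graph n \<boxtimes> path_graph m)" "card F = k"
      "domination_number (path_graph n \<boxtimes> path_graph m)
          < domination_number (delete_edges (path_graph n \<boxtimes> path_graph m) F)"
      by blast
    then show "3 \<le> k"
      using domination_number_two_edges_deleted[OF t, of F r] dom assms(3,4) by force
  qed
qed

end
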